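(* Let $f=f(x,y,\lambda,\mu):\mathbb{R}^n\times\mathbb{R}^n\times\mathbb{R}\times\mathbb{R}\to\mathbb{R}^n$ be of class $C^r$ with $r\ge 2$, and consider the delay differential equation $\dot x(t)=f(x(t),x(t-1),\lambda,\mu)$. Let $l_1,l_2\in\mathbb{R}^{n*}$ be fixed row vectors and let $V=\mathbb{R}^n\times\mathbb{R}^n\times\mathbb{R}^n\times\mathbb{R}\times\mathbb{R}$. Define $H:V\to V$ for $v=(x,\varphi_1,\varphi_2,\lambda,\mu)^T$ by $$H(v)=\begin{pmatrix} f(x,x,\lambda,\mu)\\ (f_1+f_2)\varphi_1\\ (f_1+f_2)\varphi_2-(f_2+I)\varphi_1\\ l_1\varphi_1-\tfrac12 l_2f_2\varphi_1+l_1f_2\varphi_1-1\\ l_1\varphi_2-\tfrac12 l_1f_2\varphi_1+l_1f_2\varphi_2+\tfrac16 l_2f_2\varphi_1-\tfrac12 l_2f_2\varphi_2\end{pmatrix},$$ where $f_1=\frac{\partial f}{\partial x}$ and $f_2=\frac{\partial f}{\partial y}$ are evaluated at $(x,x,\lambda,\mu)$. Suppose $(x^0,\lambda^0,\mu^0)$ is a quadratic Takens-Bogdanov point of the delay differential equation (as defined in the context), with associated vectors $\phi_1^0,\phi_2^0\in\mathbb{R}^n$ satisfying the normalization $$l_1\phi_1^0-\tfrac12 l_2f_2^0\phi_1^0+l_1f_2^0\phi_1^0=1,\qquad l_1\phi_2^0-\tfrac12 l_1f_2^0\phi_1^0+l_1f_2^0\phi_2^0+\tfrac16 l_2f_2^0\phi_1^0-\tfrac12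 l_2f_2^0\phi_2^0=0,$$ so that $v^0=(x^0,\phi_1^0,\phi_2^0,\lambda^0,\mu^0)^T$ is a zero of $H$. Then $H$ is regular at $v^0$, i.e. the derivative $H_v(v^0):V\to V$ is invertible.
   Context: Notation. A superscript $0$ means evaluation at $(x^0,x^0,\lambda^0,\mu^0)$. $f_1,f_2$ are the $n\times n$ Jacobians of $f$ in its first and second ($\mathbb{R}^n$-valued) arguments; $f_\lambda,f_\mu,f_{i\lambda},f_{i\mu}$ are partial derivatives in the parameters ($i=1,2$); $f_{i1}^0,f_{i2}^0$ are the derivatives of $f_i$ in the first and second arguments, so that for $w\in\mathbb{R}^n$, $(f_{i1}^0+f_{i2}^0)w$ is the $n\times n$ matrix which is the derivative at $x^0$, in direction $w$, of $x\mapsto f_i(x,x,\lambda^0,\mu^0)$. $\mathbb{R}^{n*}$ is the space of row vectors of length $n$. Linearization. $C=C([-1,0],\mathbb{R}^n)$, $C^*=C([0,1],\mathbb{R}^{n*})$. The operator $\mathcal{A}_0$ is $\mathcal{A}_0\phi=\dot\phi$ with domain $D(\mathcal{A}_0)=\{\phi\in C^1([-1,0],\mathbb{R}^n):\dot\phi(0)=f_1^0\phi(0)+f_2^0\phi(-1)\}$. The bilinear form on $C^*\times C$ is $(\psi,\phi)=\psi(0)\phi(0)+\int_{-1}^0\psi(\xi+1)f_2^0\phi(\xi)\,d\xi$. Takens-Bogdanov (T-B) point. $(x^0,\lambda^0,\mu^0)$ is a T-B point if: (i) $f(x^0,x^0,\lambda^0,\mu^0)=0$; (ii) $\mathcal{N}(\mathcal{A}_0)=\mathrm{span}\{\phi_1\}$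 with $\phi_1\ne0$; (iii) $\mathcal{R}(\mathcal{A}_0)=\{\gamma\in C:(\psi_2,\gamma)=0\}$ for some $\psi_2 \in C^*$; (iv) $\phi_1\in\mathcal{R}(\mathcal{A}_0)$. Associated vectors. The functions can be taken as $\phi_1(\theta)=\phi_1^0$, $\phi_2(\theta)=\phi_2^0+\theta\phi_1^0$ for $\theta\in[-1,0]$, and $\psi_2(s)=\psi_2^0$, $\psi_1(s)=\psi_1^0-s\psi_2^0$ for $s\in[0,1]$, where $\phi_1^0\in\mathbb{R}^n\setminus\{0\}$, $\phi_2^0\in\mathbb{R}^n$, $\psi_2^0\in\mathbb{R}^{n*}\setminus\{0\}$, $\psi_1^0\in\mathbb{R}^{n*}$ satisfy (1) $(f_1^0+f_2^0)\phi_1^0=0$; (2) $(f_1^0+f_2^0)\phi_2^0=(f_2^0+I)\phi_1^0$; (3) $\psi_2^0(f_1^0+f_2^0)=0$; (4) $\psi_1^0(f_1^0+f_2^0)=\psi_2^0(f_2^0+I)$; (5) $\psi_1^0\phi_1^0-\frac12\psi_2^0f_2^0\phi_1^0+\psi_1^0f_2^0\phi_1^0=1$; (6) $\psi_1^0\phi_2^0-\frac12\psi_1^0f_2^0\phi_1^0+\psi_1^0f_2^0\phi_2^0+\frac16\psi_2^0f_2^0\phi_1^0-\frac12\psi_2^0f_2^0\phi_2^0=0$. Quadratic T-B point. $(x^0,\lambda^0,\mu^0)$ is a quadratic T-B point, with associated vectors $\phi_1^0\in\mathbb{R}^n\setminus\{0\}$, $\phi_2^0\in\mathbb{R}^n$,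 $\psi_1^0\in\mathbb{R}^{n*}$, $\psi_2^0\in\mathbb{R}^{n*}\setminus\{0\}$ satisfying $(f_1^0+f_2^0)\phi_1^0=0$, $(f_1^0+f_2^0)\phi_2^0=(f_2^0+I)\phi_1^0$, $\psi_2^0(f_1^0+f_2^0)=0$, $\psi_1^0(f_1^0+f_2^0)=\psi_2^0(f_2^0+I)$, $\psi_1^0\phi_1^0-\frac12\psi_2^0f_2^0\phi_1^0+\psi_1^0f_2^0\phi_1^0=1$ and $\psi_1^0\phi_2^0-\frac12\psi_1^0f_2^0\phi_1^0+\psi_1^0f_2^0\phi_2^0+\frac16\psi_2^0f_2^0\phi_1^0-\frac12\psi_2^0f_2^0\phi_2^0=0$, if it is a T-B point and (i) $\psi_2^0f_\lambda^0\neq0$; (ii) $d_0=\det\begin{pmatrix}\psi_2^0(A_1+A_2)\phi_1^0&\psi_2^0(B_1+B_2)\phi_1^0\\ \psi_1^0(A_1+A_2)\phi_1^0+\psi_2^0(A_1+A_2)\phi_2^0-\psi_2^0A_2\phi_1^0&\psi_1^0(B_1+B_2)\phi_1^0+\psi_2^0(B_1+B_2)\phi_2^0-\psi_2^0B_2\phi_1^0\end{pmatrix}\neq0$; (iii) $\psi_2^0\phi_2^0-\frac12\psi_2^0f_2^0\phi_1^0+\psi_2^0f_2^0\phi_2^0\ne0$, where, for $i=1,2$, $A_i=(f_{i1}^0+f_{i2}^0)\phi_1^0$ and $B_i=(f_{i1}^0+f_{i2}^0)\nu_{\lambda\mu}+c_{\lambda\mu}f_{i\lambda}^0+f_{i\mu}^0$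 (all $n\times n$ matrices), $c_{\lambda\mu}=-\frac{\psi_2^0f_\mu^0}{\psi_2^0f_\lambda^0}$, and $\nu_{\lambda\mu}\in\mathbb{R}^n$ satisfies $(f_1^0+f_2^0)\nu_{\lambda\mu}+c_{\lambda\mu}f_\lambda^0+f_\mu^0=0$ and $l_1\nu_{\lambda\mu}-\frac12l_2f_2^0\nu_{\lambda\mu}+l_1f_2^0\nu_{\lambda\mu}=0$. *)

theory Defs
  imports "HOL-Analysis.Analysis"
begin

section \<open>Functions of class \<open>C\<^sup>r\<close>\<close>

text \<open>In finite dimension, \<open>f\<close> is \<open>C\<^sup>k\<^sup>+\<^sup>1\<close> iff it is differentiable and every directional
  derivative \<open>x \<mapsto> Df(x) v\<close> is \<open>C\<^sup>k\<close>.\<close>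

primrec class_C :: "nat \<Rightarrow> ('a::euclidean_space \<Rightarrow> 'b::euclidean_space) \<Rightarrow> bool" where
  "class_C 0 f \<longleftrightarrow> continuous_on UNIV f"
| "class_C (Suc k) f \<longleftrightarrow>
     (\<forall>x. f differentiable (at x)) \<and> (\<forall>v. class_C k (\<lambda>x. frechet_derivative f (at x) v))"


section \<open>Partial derivatives\<close>

text \<open>The arguments of \<open>f\<close> are packed as \<open>(x, y, \<lambda>, \<mu>)\<close>. The target type is left general because
  the operators are applied both to \<open>f\<close> and to its matrix-valued Jacobians.\<close>

type_synonym 'n args = "(real^'n) \<times> (real^'n) \<times> real \<times> real"

fun D_x :: "('n::finite args \<Rightarrow> 'b::real_normed_vector) \<Rightarrow> 'n args \<Rightarrow> real^'n \<Rightarrow> 'b" where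
  "D_x g (x, y, l, m) = frechet_derivative (\<lambda>u. g (u, y, l, m)) (at x)"

fun D_y :: "('n::finite args \<Rightarrow> 'b::real_normed_vector) \<Rightarrow> 'n args \<Rightarrow> real^'n \<Rightarrow> 'b" where
  "D_y g (x, y, l, m) = frechet_derivative (\<lambda>u. g (x, u, l, m)) (at y)"

fun D_lam :: "('n::finite args \<Rightarrow> 'b::real_normed_vector) \<Rightarrow> 'n args \<Rightarrow> 'b" where
  "D_lam g (x, y, l, m) = vector_derivative (\<lambda>s. g (x, y, s, m)) (at l)"

fun D_mu :: "('n::finite args \<Rightarrow> 'b::real_normed_vector) \<Rightarrow> 'n args \<Rightarrow> 'b" where
  "D_mu g (x, y, l, m) = vector_derivative (\<lambda>s. g (x, y, l, s)) (at m)"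

definition jac1 :: "('n::finite args \<Rightarrow> real^'n) \<Rightarrow> 'n args \<Rightarrow> real^'n^'n" where
  "jac1 f z = matrix (D_x f z)"

definition jac2 :: "('n::finite args \<Rightarrow> real^'n) \<Rightarrow> 'n args \<Rightarrow> real^'n^'n" where
  "jac2 f z = matrix (D_y f z)"


section \<open>The linearized operator and Takens-Bogdanov points\<close>

text \<open>A function on an interval \<open>I\<close> is represented by its extension by zero to the whole line, so
  that equality in \<open>C(I)\<close> is equality of HOL functions. A row vector is represented by a vector;
  its product with a column vector is the inner product, and its product with a matrix is \<open>v*\<close>.\<close>

definition C_fun :: "real set \<Rightarrow> (real \<Rightarrow> 'a::real_normed_vector) set" where
  "C_fun I = {\<phi>. continuous_on I \<phi> \<and> (\<forall>t. t \<notin> I \<longrightarrow> \<phi> t = 0)}"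

text \<open>One-sided derivatives at the end points of \<open>I\<close>.\<close>

definition C1_fun :: "real set \<Rightarrow> (real \<Rightarrow> 'a::real_normed_vector) set" where
  "C1_fun I = {\<phi> \<in> C_fun I. \<exists>\<phi>'. continuous_on I \<phi>' \<and>
                 (\<forall>t\<in>I. (\<phi> has_vector_derivative \<phi>' t) (at t within I))}"

definition fun_deriv :: "real set \<Rightarrow> (real \<Rightarrow> 'a::real_normed_vector) \<Rightarrow> real \<Rightarrow> 'a" where
  "fun_deriv I \<phi> = (\<lambda>t. if t \<in> I then vector_derivative \<phi> (at t within I) else 0)"

text \<open>The operator \<open>A\<^sub>0 \<phi> = \<phi>'\<close>; \<open>F1\<close> and \<open>F2\<close> are the Jacobians, which enter through its domain.\<close>

definition dom_A :: "real^'n^'n \<Rightarrow> real^'n^'n \<Rightarrow> (real \<Rightarrow> real^'n::finite) set" where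
  "dom_A F1 F2 = {\<phi> \<in> C1_fun {-1..0}.
                    fun_deriv {-1..0} \<phi> 0 = F1 *v \<phi> 0 + F2 *v \<phi> (-1)}"

definition null_A :: "real^'n^'n \<Rightarrow> real^'n^'n \<Rightarrow> (real \<Rightarrow> real^'n::finite) set" where
  "null_A F1 F2 = {\<phi> \<in> dom_A F1 F2. fun_deriv {-1..0} \<phi> = (\<lambda>_. 0)}"

definition range_A :: "real^'n^'n \<Rightarrow> real^'n^'n \<Rightarrow> (real \<Rightarrow> real^'n::finite) set" where
  "range_A F1 F2 = fun_deriv {-1..0} ` dom_A F1 F2"

definition pairing :: "real^'n^'n \<Rightarrow> (real \<Rightarrow> real^'n) \<Rightarrow> (real \<Rightarrow> real^'n::finite) \<Rightarrow> real" where
  "pairing F2 \<psi> \<phi> = \<psi> 0 \<bullet> \<phi> 0 + integral {-1..0} (\<lambda>\<xi>. \<psi> (\<xi> + 1) \<bullet> (F2 *v \<phi> \<xi>))"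

definition TB_point :: "('n::finite args \<Rightarrow> real^'n) \<Rightarrow> real^'n \<Rightarrow> real \<Rightarrow> real \<Rightarrow> bool" where
  "TB_point f x l m \<longleftrightarrow>
     (let z = (x, x, l, m); F1 = jac1 f z; F2 = jac2 f z in
        f z = 0 \<and>
        (\<exists>\<phi>\<^sub>1 \<in> C_fun {-1..0}. \<phi>\<^sub>1 \<noteq> (\<lambda>_. 0) \<and>
            null_A F1 F2 = {\<lambda>t. c *\<^sub>R \<phi>\<^sub>1 t | c. True} \<and>
            \<phi>\<^sub>1 \<in> range_A F1 F2) \<and>
        (\<exists>\<psi>\<^sub>2 \<in> C_fun {0..1}. range_A F1 F2 = {\<gamma> \<in> C_fun {-1..0}. pairing F2 \<psi>\<^sub>2 \<gamma> = 0}))"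


section \<open>Quadratic Takens-Bogdanov points\<close>

text \<open>For \<open>\<psi>(s) = p - s q\<close>, these are the values of \<open>pairing F2 \<psi> \<phi>\<close> at \<open>\<phi>(\<theta>) = u\<close> and at
  \<open>\<phi>(\<theta>) = w + \<theta> u\<close>, respectively.\<close>

definition nform1 :: "real^'n^'n \<Rightarrow> real^'n \<Rightarrow> real^'n \<Rightarrow> real^'n::finite \<Rightarrow> real" where
  "nform1 F2 p q u = p \<bullet> u - 1/2 * (q \<bullet> (F2 *v u)) + p \<bullet> (F2 *v u)"

definition nform2 ::
  "real^'n^'n \<Rightarrow> real^'n \<Rightarrow> real^'n \<Rightarrow> real^'n \<Rightarrow> real^'n::finite \<Rightarrow> real" where
  "nform2 F2 p q u w =
     p \<bullet> w - 1/2 * (p \<bullet> (F2 *v u)) + p \<bullet> (F2 *v w)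
       + 1/6 * (q \<bullet> (F2 *v u)) - 1/2 * (q \<bullet> (F2 *v w))"

definition associated_vectors ::
  "real^'n^'n \<Rightarrow> real^'n^'n \<Rightarrow> real^'n \<Rightarrow> real^'n \<Rightarrow> real^'n \<Rightarrow> real^'n::finite \<Rightarrow> bool" where
  "associated_vectors F1 F2 \<phi>\<^sub>1 \<phi>\<^sub>2 \<psi>\<^sub>1 \<psi>\<^sub>2 \<longleftrightarrow>
     \<phi>\<^sub>1 \<noteq> 0 \<and> \<psi>\<^sub>2 \<noteq> 0 \<and>
     (F1 + F2) *v \<phi>\<^sub>1 = 0 \<and>
     (F1 + F2) *v \<phi>\<^sub>2 = (F2 + mat 1) *v \<phi>\<^sub>1 \<and>
     \<psi>\<^sub>2 v* (F1 + F2) = 0 \<and>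
     \<psi>\<^sub>1 v* (F1 + F2) = \<psi>\<^sub>2 v* (F2 + mat 1) \<and>
     nform1 F2 \<psi>\<^sub>1 \<psi>\<^sub>2 \<phi>\<^sub>1 = 1 \<and>
     nform2 F2 \<psi>\<^sub>1 \<psi>\<^sub>2 \<phi>\<^sub>1 \<phi>\<^sub>2 = 0"

text \<open>The matrices \<open>A\<^sub>i\<close> and \<open>B\<^sub>i\<close> are obtained with \<open>G = jac1 f\<close> for \<open>i = 1\<close> and \<open>G = jac2 f\<close> for
  \<open>i = 2\<close>.\<close>

definition A_mat ::
  "('n args \<Rightarrow> real^'n^'n) \<Rightarrow> 'n args \<Rightarrow> real^'n::finite \<Rightarrow> real^'n^'n" where
  "A_mat G z \<phi> = D_x G z \<phi> + D_y G z \<phi>"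

definition B_mat ::
  "('n args \<Rightarrow> real^'n^'n) \<Rightarrow> 'n args \<Rightarrow> real^'n::finite \<Rightarrow> real \<Rightarrow> real^'n^'n" where
  "B_mat G z \<nu> c = D_x G z \<nu> + D_y G z \<nu> + c *\<^sub>R D_lam G z + D_mu G z"

definition d0 :: "('n::finite args \<Rightarrow> real^'n) \<Rightarrow> 'n args \<Rightarrow>
    real^'n \<Rightarrow> real^'n \<Rightarrow> real^'n \<Rightarrow> real^'n \<Rightarrow> real^'n \<Rightarrow> real \<Rightarrow> real" where
  "d0 f z \<phi>\<^sub>1 \<phi>\<^sub>2 \<psi>\<^sub>1 \<psi>\<^sub>2 \<nu> c =
     (let A1 = A_mat (jac1 f) z \<phi>\<^sub>1; A2 = A_mat (jac2 f) z \<phi>\<^sub>1;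
          B1 = B_mat (jac1 f) z \<nu> c; B2 = B_mat (jac2 f) z \<nu> c
      in det (vector [
           vector [\<psi>\<^sub>2 \<bullet> ((A1 + A2) *v \<phi>\<^sub>1),
                   \<psi>\<^sub>2 \<bullet> ((B1 + B2) *v \<phi>\<^sub>1)],
           vector [\<psi>\<^sub>1 \<bullet> ((A1 + A2) *v \<phi>\<^sub>1) + \<psi>\<^sub>2 \<bullet> ((A1 + A2) *v \<phi>\<^sub>2) - \<psi>\<^sub>2 \<bullet> (A2 *v \<phi>\<^sub>1),
                   \<psi>\<^sub>1 \<bullet> ((B1 + B2) *v \<phi>\<^sub>1) + \<psi>\<^sub>2 \<bullet> ((B1 + B2) *v \<phi>\<^sub>2) - \<psi>\<^sub>2 \<bullet> (B2 *v \<phi>\<^sub>1)]]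
         :: real^2^2))"

text \<open>The row vectors \<open>l\<^sub>1, l\<^sub>2\<close> only serve to normalize \<open>\<nu>\<close>, which is otherwise determined up to
  a multiple of \<open>\<phi>\<^sub>1\<close>.\<close>

definition quadratic_TB_point :: "('n::finite args \<Rightarrow> real^'n) \<Rightarrow> real^'n \<Rightarrow> real^'n \<Rightarrow>
    real^'n \<Rightarrow> real \<Rightarrow> real \<Rightarrow> real^'n \<Rightarrow> real^'n \<Rightarrow> real^'n \<Rightarrow> real^'n \<Rightarrow> bool" where
  "quadratic_TB_point f l\<^sub>1 l\<^sub>2 x l m \<phi>\<^sub>1 \<phi>\<^sub>2 \<psi>\<^sub>1 \<psi>\<^sub>2 \<longleftrightarrow>
     (let z = (x, x, l, m); F1 = jac1 f z; F2 = jac2 f z;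
          c = - (\<psi>\<^sub>2 \<bullet> D_mu f z) / (\<psi>\<^sub>2 \<bullet> D_lam f z) in
        TB_point f x l m \<and>
        associated_vectors F1 F2 \<phi>\<^sub>1 \<phi>\<^sub>2 \<psi>\<^sub>1 \<psi>\<^sub>2 \<and>
        \<psi>\<^sub>2 \<bullet> D_lam f z \<noteq> 0 \<and>
        (\<exists>\<nu>. (F1 + F2) *v \<nu> + c *\<^sub>R D_lam f z + D_mu f z = 0 \<and>
             nform1 F2 l\<^sub>1 l\<^sub>2 \<nu> = 0 \<and>
             d0 f z \<phi>\<^sub>1 \<phi>\<^sub>2 \<psi>\<^sub>1 \<psi>\<^sub>2 \<nu> c \<noteq> 0) \<and>
        \<psi>\<^sub>2 \<bullet> \<phi>\<^sub>2 - 1/2 * (\<psi>\<^sub>2 \<bullet> (F2 *v \<phi>\<^sub>1)) + \<psi>\<^sub>2 \<bullet> (F2 *v \<phi>\<^sub>2) \<noteq> 0)"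


section \<open>The defining system\<close>

type_synonym 'n vars = "(real^'n) \<times> (real^'n) \<times> (real^'n) \<times> real \<times> real"

text \<open>The last two real components are the two normalization equations.\<close>

fun H_sys :: "('n::finite args \<Rightarrow> real^'n) \<Rightarrow> real^'n \<Rightarrow> real^'n \<Rightarrow> 'n vars \<Rightarrow> 'n vars" where
  "H_sys f l\<^sub>1 l\<^sub>2 (x, \<phi>\<^sub>1, \<phi>\<^sub>2, l, m) =
     (let z = (x, x, l, m); F1 = jac1 f z; F2 = jac2 f z in
       (f z,
        (F1 + F2) *v \<phi>\<^sub>1,
        (F1 + F2) *v \<phi>\<^sub>2 - (F2 + mat 1) *v \<phi>\<^sub>1,
        nform1 F2 l\<^sub>1 l\<^sub>2 \<phi>\<^sub>1 - 1,
        nform2 F2 l\<^sub>1 l\<^sub>2 \<phi>\<^sub>1 \<phi>\<^sub>2))"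

definition regular_at :: "('a::real_normed_vector \<Rightarrow> 'b::real_normed_vector) \<Rightarrow> 'a \<Rightarrow> bool" where
  "regular_at h v \<longleftrightarrow> h differentiable (at v) \<and> bij (frechet_derivative h (at v))"

end

theory Submission
  imports Defs
begin

text \<open>An element \<open>(x, a, b, s, t)\<close> of the kernel of \<open>H\<^sub>v(v\<^sup>0)\<close> is shown to vanish. The first
  component, multiplied by \<open>\<psi>\<^sub>2\<close>, gives \<open>s = c t\<close>, hence \<open>x = t \<nu> + k \<phi>\<^sub>1\<close> because
  \<open>f\<^sub>1 + f\<^sub>2\<close> has kernel \<open>span {\<phi>\<^sub>1}\<close>. Multiplying the second component by \<open>\<psi>\<^sub>2\<close>, and adding \<open>\<psi>\<^sub>1\<close> times
  the second component to \<open>\<psi>\<^sub>2\<close> times the third one, eliminates \<open>a\<close> and \<open>b\<close> and leaves the linear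
  system with determinant \<open>d\<^sub>0\<close> for \<open>(k, t)\<close>. So \<open>x, s, t\<close> vanish, then \<open>a = \<alpha> \<phi>\<^sub>1\<close> and
  \<open>b = \<alpha> \<phi>\<^sub>2 + \<beta> \<phi>\<^sub>1\<close>, and the two normalization equations force \<open>\<alpha> = \<beta> = 0\<close>.\<close>

section \<open>Product rule for matrix times vector\<close>

lemma bounded_bilinear_matrix_vector_mult:
  "bounded_bilinear ((*v) :: real^'n^'m \<Rightarrow> real^'n \<Rightarrow> real^'m)"
proof -
  have "bilinear ((*v) :: real^'n^'m \<Rightarrow> real^'n \<Rightarrow> real^'m)"
    unfolding bilinear_def
    by (auto intro!: linearI simp: matrix_vector_mult_add_rdistrib matrix_vector_right_distrib
        scaleR_matrix_vector_assoc matrix_vector_mult_scaleR)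
  then show ?thesis
    by (simp add: bilinear_conv_bounded_bilinear)
qed

lemmas has_derivative_matrix_vector_mult [derivative_intros] =
  bounded_bilinear.FDERIV[OF bounded_bilinear_matrix_vector_mult]

section \<open>Partial derivatives as values of the total derivative\<close>

lemma D_x_eq:
  assumes "(g has_derivative g') (at (x, y, l, m))"
  shows "D_x g (x, y, l, m) = (\<lambda>u. g' (u, 0, 0, 0))"
proof -
  have "((\<lambda>u. (u, y, l, m)) has_derivative (\<lambda>u. (u, 0, 0, 0))) (at x)"
    by (auto intro!: derivative_eq_intros simp: zero_prod_def)
  from has_derivative_compose[OF this assms] show ?thesis
    by (simp add: frechet_derivative_at[symmetric])
qed

lemma D_y_eq:
  assumes "(g has_derivative g') (at (x, y, l, m))"
  shows "D_y g (x, y, l, m) = (\<lambda>u. g' (0, u, 0, 0))"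
proof -
  have "((\<lambda>u. (x, u, l, m)) has_derivative (\<lambda>u. (0, u, 0, 0))) (at y)"
    by (auto intro!: derivative_eq_intros simp: zero_prod_def)
  from has_derivative_compose[OF this assms] show ?thesis
    by (simp add: frechet_derivative_at[symmetric])
qed

lemma D_lam_eq:
  assumes "(g has_derivative g') (at (x, y, l, m))"
  shows "D_lam g (x, y, l, m) = g' (0, 0, 1, 0)"
proof -
  have "((\<lambda>s. (x, y, s, m)) has_derivative (\<lambda>s. (0, 0, s, 0))) (at l)"
    by (auto intro!: derivative_eq_intros simp: zero_prod_def)
  from has_derivative_compose[OF this assms]
  have "((\<lambda>s. g (x, y, s, m)) has_derivative (\<lambda>s. g' (0, 0, s, 0))) (at l)" .
  moreover have "(\<lambda>s. g' (0, 0, s, 0)) = (\<lambda>s. s *\<^sub>R g' (0, 0, 1, 0))"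
  proof
    show "g' (0, 0, s, 0) = s *\<^sub>R g' (0, 0, 1, 0)" for s
      using linear_scale[OF has_derivative_linear[OF assms], of s "(0, 0, 1, 0)"] by simp
  qed
  ultimately have "((\<lambda>s. g (x, y, s, m)) has_vector_derivative g' (0, 0, 1, 0)) (at l)"
    by (simp add: has_vector_derivative_def)
  then show ?thesis
    by (simp add: vector_derivative_at)
qed

lemma D_mu_eq:
  assumes "(g has_derivative g') (at (x, y, l, m))"
  shows "D_mu g (x, y, l, m) = g' (0, 0, 0, 1)"
proof -
  have "((\<lambda>s. (x, y, l, s)) has_derivative (\<lambda>s. (0, 0, 0, s))) (at m)"
    by (auto intro!: derivative_eq_intros simp: zero_prod_def)
  from has_derivative_compose[OF this assms]
  have "((\<lambda>s. g (x, y, l, s)) has_derivative (\<lambda>s. g' (0, 0, 0, s))) (at m)" .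
  moreover have "(\<lambda>s. g' (0, 0, 0, s)) = (\<lambda>s. s *\<^sub>R g' (0, 0, 0, 1))"
  proof
    show "g' (0, 0, 0, s) = s *\<^sub>R g' (0, 0, 0, 1)" for s
      using linear_scale[OF has_derivative_linear[OF assms], of s "(0, 0, 0, 1)"] by simp
  qed
  ultimately have "((\<lambda>s. g (x, y, l, s)) has_vector_derivative g' (0, 0, 0, 1)) (at m)"
    by (simp add: has_vector_derivative_def)
  then show ?thesis
    by (simp add: vector_derivative_at)
qed

text \<open>Linearity along the four coordinate blocks. Applied to \<open>f\<close> and to its
  Jacobians, it expresses derivatives in direction \<open>(x, x, s, t)\<close> through the operators
  that occur in \<open>A_mat\<close> and \<open>B_mat\<close>.\<close>

lemma total_derivative:
  assumes "(g has_derivative g') (at z)"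
  shows "g' (u, w, s, t) = D_x g z u + D_y g z w + s *\<^sub>R D_lam g z + t *\<^sub>R D_mu g z"
proof -
  obtain x y l m where z: "z = (x, y, l, m)"
    by (cases z) auto
  note lin = has_derivative_linear[OF assms]
  have "(u, w, s, t) = (u, 0, 0, 0) + (0, w, 0, 0) + s *\<^sub>R (0, 0, 1, 0) + t *\<^sub>R (0, 0, 0, 1)"
    by simp
  then have "g' (u, w, s, t) = g' (u, 0, 0, 0) + g' (0, w, 0, 0)
      + s *\<^sub>R g' (0, 0, 1, 0) + t *\<^sub>R g' (0, 0, 0, 1)"
    by (simp only: linear_add[OF lin] linear_scale[OF lin])
  then show ?thesis
    using assms unfolding z by (simp only: D_x_eq D_y_eq D_lam_eq D_mu_eq)
qed

lemma linear_D_x: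
  assumes "(g has_derivative g') (at z)"
  shows "linear (D_x g z)"
proof -
  obtain x y l m where z: "z = (x, y, l, m)"
    by (cases z) auto
  have "linear (g' \<circ> (\<lambda>u. (u, 0, 0, 0)))"
    by (intro linear_compose[OF _ has_derivative_linear[OF assms]] linearI) auto
  with D_x_eq[OF assms[unfolded z]] show ?thesis
    by (simp add: z comp_def)
qed

lemma linear_D_y:
  assumes "(g has_derivative g') (at z)"
  shows "linear (D_y g z)"
proof -
  obtain x y l m where z: "z = (x, y, l, m)"
    by (cases z) auto
  have "linear (g' \<circ> (\<lambda>u. (0, u, 0, 0)))"
    by (intro linear_compose[OF _ has_derivative_linear[OF assms]] linearI) auto
  with D_y_eq[OF assms[unfolded z]] show ?thesis
    by (simp add: z comp_def)
qed

section \<open>Differentiability of the Jacobians\<close>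

lemma differentiable_componentwise_matrix:
  fixes G :: "'a::real_normed_vector \<Rightarrow> real^'n^'m"
  assumes "\<And>i j. (\<lambda>x. G x $ i $ j) differentiable (at x)"
  shows "G differentiable (at x)"
proof -
  have "(\<lambda>x. G x $ i) differentiable (at x)" for i
    using assms
    by (subst differentiable_componentwise_within) (auto simp: Basis_vec_def inner_axis)
  then have "(\<lambda>x. G x \<bullet> axis i u) differentiable (at x)" for i u
    by (auto simp: inner_axis intro!: differentiable_inner)
  then show ?thesis
    by (subst differentiable_componentwise_within) (auto simp: Basis_vec_def)
qed

lemma class_C_2_differentiable:
  assumes "r \<ge> 2" "class_C r f"
  shows "f differentiable (at x)" "(\<lambda>x. frechet_derivative f (at x) v) differentiable (at x)"
proof -
  obtain k where "r = Suc (Suc k)"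
    using assms(1) by (metis add_2_eq_Suc le_Suc_ex)
  with assms(2) show "f differentiable (at x)"
    "(\<lambda>x. frechet_derivative f (at x) v) differentiable (at x)"
    by auto
qed

text \<open>Each Jacobian entry is a coordinate of a directional derivative of \<open>f\<close> in a
  fixed basis direction, and class C^2 makes such directional derivatives differentiable.\<close>

lemma jac_differentiable:
  fixes f :: "'n::finite args \<Rightarrow> real^'n"
  assumes "r \<ge> 2" "class_C r f"
  shows "jac1 f differentiable (at z)" "jac2 f differentiable (at z)"
proof -
  note df = class_C_2_differentiable[OF assms]
  have f': "(f has_derivative frechet_derivative f (at z)) (at z)" for z
    using df(1) frechet_derivative_works by blast
  have coord: "(\<lambda>z. frechet_derivative f (at z) v $ i) differentiable (at z)" for v i z
    using differentiable_inner[OF df(2)[of v z] differentiable_const[of "axis i 1"]]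
    by (simp add: inner_axis)
  have "jac1 f z $ i $ j = frechet_derivative f (at z) (axis j 1, 0, 0, 0) $ i" for z i j
    using f'[of z] by (cases z) (simp add: jac1_def matrix_def D_x_eq del: D_x.simps)
  then show "jac1 f differentiable (at z)"
    by (intro differentiable_componentwise_matrix) (simp only: coord)
  have "jac2 f z $ i $ j = frechet_derivative f (at z) (0, axis j 1, 0, 0) $ i" for z i j
    using f'[of z] by (cases z) (simp add: jac2_def matrix_def D_y_eq del: D_y.simps)
  then show "jac2 f differentiable (at z)"
    by (intro differentiable_componentwise_matrix) (simp only: coord)
qed

section \<open>The kernel of \<open>F1 + F2\<close> at a Takens-Bogdanov point\<close>

text \<open>A constant function has derivative zero, so the boundary condition in
  \<open>dom_A\<close> reduces to \<open>F1 *v v + F2 *v v = 0\<close>.\<close>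

lemma const_in_null_A:
  assumes "(F1 + F2) *v v = 0"
  shows "(\<lambda>t. if t \<in> {-1..0} then v else 0) \<in> null_A F1 F2"
proof -
  let ?g = "\<lambda>t::real. if t \<in> {-1..0} then v else 0"
  have d: "(?g has_vector_derivative 0) (at t within {-1..0})" if "t \<in> {-1..0}" for t
    by (rule has_vector_derivative_transform[OF that, of _ "\<lambda>_. v"]) auto
  \<comment> \<open>The interval is nondegenerate, so derivatives within it are unique, also at the
    end points.\<close>
  have "vector_derivative ?g (at t within {-1..0}) = 0" if "t \<in> {-1..0}" for t
    using vector_derivative_within_cbox[of "-1" 0 t ?g 0] d that by simp
  then have "fun_deriv {-1..0} ?g = (\<lambda>_. 0)"
    by (auto simp: fun_deriv_def)
  moreover have "?g \<in> C_fun {-1..0}"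
    by (auto simp: C_fun_def intro: continuous_on_eq[of _ "\<lambda>_. v"])
  then have "?g \<in> C1_fun {-1..0}"
    using d by (auto simp: C1_fun_def intro!: exI[of _ "\<lambda>_. 0"])
  ultimately show ?thesis
    using assms by (auto simp: null_A_def dom_A_def matrix_vector_mult_add_rdistrib)
qed

text \<open>Transfers the one-dimensionality of \<open>null_A\<close> to matrices: the constants
  \<open>\<phi>\<close> and \<open>v\<close> both give elements of \<open>null_A\<close>, hence
  multiples of a single \<Phi>.\<close>

lemma TB_point_kernel:
  assumes TB: "TB_point f x l m"
    and F: "F1 = jac1 f (x, x, l, m)" "F2 = jac2 f (x, x, l, m)"
    and "\<phi> \<noteq> 0" "(F1 + F2) *v \<phi> = 0" "(F1 + F2) *v v = 0"
  obtains k where "v = k *\<^sub>R \<phi>"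
proof -
  obtain \<Phi> where "null_A F1 F2 = {\<lambda>t. c *\<^sub>R \<Phi> t | c. True}"
    using TB unfolding TB_point_def Let_def F by blast
  then obtain a b where
    "(\<lambda>t. if t \<in> {-1..0} then \<phi> else 0) = (\<lambda>t. a *\<^sub>R \<Phi> t)"
    "(\<lambda>t. if t \<in> {-1..0} then v else 0) = (\<lambda>t. b *\<^sub>R \<Phi> t)"
    using const_in_null_A[OF assms(5)] const_in_null_A[OF assms(6)] by auto
  from this[THEN fun_cong, of 0] have "\<phi> = a *\<^sub>R \<Phi> 0" "v = b *\<^sub>R \<Phi> 0"
    by auto
  \<comment> \<open>Here \<open>a\<close> is nonzero because \<open>\<phi>\<close> is, so the
    division is legitimate.\<close>
  with \<open>\<phi> \<noteq> 0\<close> have "v = (b / a) *\<^sub>R \<phi>"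
    by auto
  then show ?thesis ..
qed

section \<open>The derivative of the defining system\<close>

text \<open>For a fixed matrix the form is linear in \<open>u\<close>, which reproduces
  \<open>nform1\<close> at \<open>u' h\<close>; only the two terms containing the matrix contribute
  to the rest.\<close>

lemma has_derivative_nform1:
  assumes "(F has_derivative F') (at v)" "(u has_derivative u') (at v)"
  shows "((\<lambda>v. nform1 (F v) p q (u v)) has_derivative
    (\<lambda>h. nform1 (F v) p q (u' h) - 1/2 * (q \<bullet> (F' h *v u v)) + p \<bullet> (F' h *v u v))) (at v)"
proof -
  note d = has_derivative_matrix_vector_mult[OF assms]
  show ?thesis
    unfolding nform1_def
    by (auto intro!: derivative_eq_intros assms d simp: fun_eq_iff algebra_simps)
qed

lemma has_derivative_nform2:
  assumes "(F has_derivative F') (at v)" "(u has_derivative u') (at v)"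
    "(w has_derivative w') (at v)"
  shows "((\<lambda>v. nform2 (F v) p q (u v) (w v)) has_derivative
    (\<lambda>h. nform2 (F v) p q (u' h) (w' h) - 1/2 * (p \<bullet> (F' h *v u v)) + p \<bullet> (F' h *v w v)
       + 1/6 * (q \<bullet> (F' h *v u v)) - 1/2 * (q \<bullet> (F' h *v w v)))) (at v)"
proof -
  note d = has_derivative_matrix_vector_mult[OF assms(1,2)]
    has_derivative_matrix_vector_mult[OF assms(1,3)]
  show ?thesis
    unfolding nform2_def
    by (rule has_derivative_eq_rhs, (rule has_derivative_add has_derivative_diff
          has_derivative_mult_right has_derivative_inner_right assms d)+)
      (simp add: fun_eq_iff algebra_simps)
qed

lemma has_derivative_H_sys:
  assumes f: "(f has_derivative f') (at (x, x, l, m))"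
    and 1: "(jac1 f has_derivative J1) (at (x, x, l, m))"
    and 2: "(jac2 f has_derivative J2) (at (x, x, l, m))"
    and F: "F1 = jac1 f (x, x, l, m)" "F2 = jac2 f (x, x, l, m)"
  shows "(H_sys f l\<^sub>1 l\<^sub>2 has_derivative (\<lambda>(y, a, b, s, t). let h = (y, y, s, t); E1 = J1 h; E2 = J2 h in
     (f' h,
      (F1 + F2) *v a + (E1 + E2) *v \<phi>\<^sub>1,
      (F1 + F2) *v b - (F2 + mat 1) *v a + (E1 + E2) *v \<phi>\<^sub>2 - E2 *v \<phi>\<^sub>1,
      nform1 F2 l\<^sub>1 l\<^sub>2 a - 1/2 * (l\<^sub>2 \<bullet> (E2 *v \<phi>\<^sub>1)) + l\<^sub>1 \<bullet> (E2 *v \<phi>\<^sub>1),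
      nform2 F2 l\<^sub>1 l\<^sub>2 a b - 1/2 * (l\<^sub>1 \<bullet> (E2 *v \<phi>\<^sub>1)) + l\<^sub>1 \<bullet> (E2 *v \<phi>\<^sub>2)
        + 1/6 * (l\<^sub>2 \<bullet> (E2 *v \<phi>\<^sub>1)) - 1/2 * (l\<^sub>2 \<bullet> (E2 *v \<phi>\<^sub>2)))))
     (at (x, \<phi>\<^sub>1, \<phi>\<^sub>2, l, m))"
proof -
  let ?v = "(x, \<phi>\<^sub>1, \<phi>\<^sub>2, l, m)"
  \<comment> \<open>The linear map sending the unknowns to the diagonal point where \<open>f\<close>
    and its Jacobians are evaluated. It is its own derivative, so the chain rule puts
    \<open>(y, y, s, t)\<close> into \<open>f'\<close>, \<open>J1\<close> and
    \<open>J2\<close>.\<close>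
  define \<zeta> where "\<zeta> = (\<lambda>v::'a vars. (fst v, fst v, fst (snd (snd (snd v))), snd (snd (snd (snd v)))))"
  have \<zeta>: "(\<zeta> has_derivative \<zeta>) (at ?v)"
    unfolding \<zeta>_def by (auto intro!: derivative_eq_intros simp: zero_prod_def)
  have \<zeta>v: "\<zeta> ?v = (x, x, l, m)"
    by (simp add: \<zeta>_def)
  note d = has_derivative_compose[OF \<zeta>, unfolded \<zeta>v]
  note df = d[OF f] and d1 = d[OF 1] and d2 = d[OF 2]
  have da: "((\<lambda>v. fst (snd v)) has_derivative (\<lambda>h. fst (snd h))) (at ?v)"
    and db: "((\<lambda>v. fst (snd (snd v))) has_derivative (\<lambda>h. fst (snd (snd h)))) (at ?v)"
    by (auto intro!: derivative_eq_intros simp: zero_prod_def)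
  have H: "H_sys f l\<^sub>1 l\<^sub>2 = (\<lambda>v. (f (\<zeta> v),
     (jac1 f (\<zeta> v) + jac2 f (\<zeta> v)) *v fst (snd v),
     (jac1 f (\<zeta> v) + jac2 f (\<zeta> v)) *v fst (snd (snd v)) - (jac2 f (\<zeta> v) + mat 1) *v fst (snd v),
     nform1 (jac2 f (\<zeta> v)) l\<^sub>1 l\<^sub>2 (fst (snd v)) - 1,
     nform2 (jac2 f (\<zeta> v)) l\<^sub>1 l\<^sub>2 (fst (snd v)) (fst (snd (snd v)))))"
    by (auto simp: fun_eq_iff \<zeta>_def Let_def)
  note d12 = has_derivative_add[OF d1 d2] and d2' = has_derivative_add[OF d2 has_derivative_const]
  note mv = has_derivative_matrix_vector_mult
  note comps = has_derivative_Pair[OF df has_derivative_Pair[OF mv[OF d12 da]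
        has_derivative_Pair[OF has_derivative_diff[OF mv[OF d12 db] mv[OF d2' da]]
          has_derivative_Pair[OF has_derivative_diff[OF has_derivative_nform1[OF d2 da] has_derivative_const]
            has_derivative_nform2[OF d2 da db]]]]]
  show ?thesis
    unfolding H
    by (rule has_derivative_eq_rhs[OF comps]) (auto simp: fun_eq_iff \<zeta>_def Let_def F)
qed

section \<open>Triviality of the kernel of the derivative\<close>

lemma det_2_trivial_kernel:
  fixes a b c d k t :: real
  assumes "det (vector [vector [a, b], vector [c, d]] :: real^2^2) \<noteq> 0"
    and "k * a + t * b = 0" "k * c + t * d = 0"
  shows "k = 0" "t = 0"
proof -
  have D: "a * d - b * c \<noteq> 0"
    using assms(1) by (simp add: det_2)
  \<comment> \<open>Cramer's rule: combine the two equations with cofactors as coefficients.\<close>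
  have "k * (a * d - b * c) = 0" "t * (a * d - b * c) = 0"
    using assms(2,3) by algebra+
  with D show "k = 0" "t = 0"
    by auto
qed

text \<open>The premises \<open>k1\<close> to \<open>k5\<close> are the five components of the
  derivative at \<open>(x, a, b, s, t)\<close>; \<open>E1\<close> and \<open>E2\<close> are the
  variations of the Jacobians in the diagonal direction \<open>h\<close>.\<close>

lemma H_sys_derivative_kernel:
  assumes f: "(f has_derivative f') (at z)"
    and 1: "(jac1 f has_derivative J1) (at z)"
    and 2: "(jac2 f has_derivative J2) (at z)"
    and z: "z = (x0, x0, lam0, mu0)"
    and F: "F1 = jac1 f z" "F2 = jac2 f z"
    and Q: "quadratic_TB_point f l\<^sub>1 l\<^sub>2 x0 lam0 mu0 \<phi>\<^sub>1 \<phi>\<^sub>2 \<psi>\<^sub>1 \<psi>\<^sub>2"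
    and norm: "nform1 F2 l\<^sub>1 l\<^sub>2 \<phi>\<^sub>1 = 1"
    and h: "h = (x, x, s, t)"
    and E: "E1 = J1 h" "E2 = J2 h"
    and k1: "f' h = 0"
    and k2: "(F1 + F2) *v a + (E1 + E2) *v \<phi>\<^sub>1 = 0"
    and k3: "(F1 + F2) *v b - (F2 + mat 1) *v a + (E1 + E2) *v \<phi>\<^sub>2 - E2 *v \<phi>\<^sub>1 = 0"
    and k4: "nform1 F2 l\<^sub>1 l\<^sub>2 a - 1/2 * (l\<^sub>2 \<bullet> (E2 *v \<phi>\<^sub>1)) + l\<^sub>1 \<bullet> (E2 *v \<phi>\<^sub>1) = 0"
    and k5: "nform2 F2 l\<^sub>1 l\<^sub>2 a b - 1/2 * (l\<^sub>1 \<bullet> (E2 *v \<phi>\<^sub>1)) + l\<^sub>1 \<bullet> (E2 *v \<phi>\<^sub>2)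
        + 1/6 * (l\<^sub>2 \<bullet> (E2 *v \<phi>\<^sub>1)) - 1/2 * (l\<^sub>2 \<bullet> (E2 *v \<phi>\<^sub>2)) = 0"
  shows "(x, a, b, s, t) = 0"
proof -
  define c where "c = - (\<psi>\<^sub>2 \<bullet> D_mu f z) / (\<psi>\<^sub>2 \<bullet> D_lam f z)"
  obtain \<nu> where TB: "TB_point f x0 lam0 mu0"
    and av: "associated_vectors F1 F2 \<phi>\<^sub>1 \<phi>\<^sub>2 \<psi>\<^sub>1 \<psi>\<^sub>2"
    and lam: "\<psi>\<^sub>2 \<bullet> D_lam f z \<noteq> 0"
    and \<nu>: "(F1 + F2) *v \<nu> + c *\<^sub>R D_lam f z + D_mu f z = 0"
    and d0: "d0 f z \<phi>\<^sub>1 \<phi>\<^sub>2 \<psi>\<^sub>1 \<psi>\<^sub>2 \<nu> c \<noteq> 0"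
    using Q unfolding quadratic_TB_point_def Let_def c_def z F by blast
  have \<phi>1: "\<phi>\<^sub>1 \<noteq> 0" "(F1 + F2) *v \<phi>\<^sub>1 = 0"
    and \<phi>2: "(F1 + F2) *v \<phi>\<^sub>2 = (F2 + mat 1) *v \<phi>\<^sub>1"
    using av by (auto simp: associated_vectors_def)
  \<comment> \<open>The row-vector identities for \<open>\<psi>\<^sub>1\<close> and
    \<open>\<psi>\<^sub>2\<close>, tested on arbitrary \<open>u\<close> so that they can be applied
    to \<open>a\<close>, \<open>b\<close> and \<open>x\<close>.\<close>
  have \<psi>2: "\<psi>\<^sub>2 \<bullet> ((F1 + F2) *v u) = 0"
    and \<psi>1: "\<psi>\<^sub>1 \<bullet> ((F1 + F2) *v u) = \<psi>\<^sub>2 \<bullet> ((F2 + mat 1) *v u)" for u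
    using av by (simp_all add: associated_vectors_def flip: dot_lmul_matrix)
  note kernel = TB_point_kernel[OF TB F[unfolded z] \<phi>1]
  note dl = linear_add[OF linear_D_x] linear_scale[OF linear_D_x]
    linear_add[OF linear_D_y] linear_scale[OF linear_D_y]

  have DF: "D_x f z u + D_y f z u = (F1 + F2) *v u" for u
    by (simp add: F jac1_def jac2_def matrix_vector_mult_add_rdistrib
        matrix_vector_mul(2)[OF linear_D_x[OF f], THEN fun_cong]
        matrix_vector_mul(2)[OF linear_D_y[OF f], THEN fun_cong])
  have k1': "(F1 + F2) *v x + s *\<^sub>R D_lam f z + t *\<^sub>R D_mu f z = 0"
    using k1 unfolding h total_derivative[OF f] DF .
  then have "\<psi>\<^sub>2 \<bullet> ((F1 + F2) *v x + s *\<^sub>R D_lam f z + t *\<^sub>R D_mu f z) = 0"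
    by simp
  then have "s * (\<psi>\<^sub>2 \<bullet> D_lam f z) + t * (\<psi>\<^sub>2 \<bullet> D_mu f z) = 0"
    by (simp add: inner_add_right \<psi>2)
  then have s: "s = t * c"
    using lam by (simp add: c_def field_simps)
  \<comment> \<open>By definition \<nu> solves the first linearized equation with parameter
    direction \<open>(c, 1)\<close>; subtracting \<open>t\<close> times that equation removes the
    parameter terms.\<close>
  have "(F1 + F2) *v (x - t *\<^sub>R \<nu>) =
      ((F1 + F2) *v x + s *\<^sub>R D_lam f z + t *\<^sub>R D_mu f z)
      - t *\<^sub>R ((F1 + F2) *v \<nu> + c *\<^sub>R D_lam f z + D_mu f z)"
    by (simp add: s matrix_vector_mult_diff_distrib matrix_vector_mult_scaleR algebra_simps)
  then have "(F1 + F2) *v (x - t *\<^sub>R \<nu>) = 0"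
    using k1' \<nu> by simp
  then obtain k where "x - t *\<^sub>R \<nu> = k *\<^sub>R \<phi>\<^sub>1"
    by (rule kernel)
  then have x: "x = k *\<^sub>R \<phi>\<^sub>1 + t *\<^sub>R \<nu>"
    by (simp add: algebra_simps)

  define A1 A2 B1 B2 where AB: "A1 = A_mat (jac1 f) z \<phi>\<^sub>1" "A2 = A_mat (jac2 f) z \<phi>\<^sub>1"
    "B1 = B_mat (jac1 f) z \<nu> c" "B2 = B_mat (jac2 f) z \<nu> c"
  \<comment> \<open>Inserting \<open>x = k \<phi>\<^sub>1 + t \<nu>\<close> and
    \<open>s = t c\<close> splits the variation into its A and B parts by linearity.\<close>
  have E1: "E1 = k *\<^sub>R A1 + t *\<^sub>R B1"
    unfolding E h total_derivative[OF 1] AB A_mat_def B_mat_def s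
    by (simp add: x dl[OF 1] algebra_simps)
  have E2: "E2 = k *\<^sub>R A2 + t *\<^sub>R B2"
    unfolding E h total_derivative[OF 2] AB A_mat_def B_mat_def s
    by (simp add: x dl[OF 2] algebra_simps)
  note mat_simps = matrix_vector_mult_add_rdistrib scaleR_matrix_vector_assoc[symmetric]
    inner_add_right inner_diff_right algebra_simps
  have "\<psi>\<^sub>2 \<bullet> ((E1 + E2) *v \<phi>\<^sub>1) = 0"
    using arg_cong[OF k2, of "inner \<psi>\<^sub>2"] \<psi>2[of a] by (simp add: inner_add_right)
  then have r1: "k * (\<psi>\<^sub>2 \<bullet> ((A1 + A2) *v \<phi>\<^sub>1)) + t * (\<psi>\<^sub>2 \<bullet> ((B1 + B2) *v \<phi>\<^sub>1)) = 0"
    by (simp add: E1 E2 mat_simps)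
  \<comment> \<open>Pairing \<open>k2\<close> with \<open>\<psi>\<^sub>1\<close> produces
    \<open>\<psi>\<^sub>2 \<bullet> ((F2 + mat 1) *v a)\<close>, which cancels against the same term
    of \<open>k3\<close> paired with \<open>\<psi>\<^sub>2\<close>.\<close>
  have "\<psi>\<^sub>1 \<bullet> ((E1 + E2) *v \<phi>\<^sub>1) + \<psi>\<^sub>2 \<bullet> ((E1 + E2) *v \<phi>\<^sub>2) - \<psi>\<^sub>2 \<bullet> (E2 *v \<phi>\<^sub>1) = 0"
    using arg_cong[OF k2, of "inner \<psi>\<^sub>1"] arg_cong[OF k3, of "inner \<psi>\<^sub>2"] \<psi>1[of a] \<psi>2[of b]
    by (simp add: inner_add_right inner_diff_right)
  then have r2: "k * (\<psi>\<^sub>1 \<bullet> ((A1 + A2) *v \<phi>\<^sub>1) + \<psi>\<^sub>2 \<bullet> ((A1 + A2) *v \<phi>\<^sub>2) - \<psi>\<^sub>2 \<bullet> (A2 *v \<phi>\<^sub>1))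
      + t * (\<psi>\<^sub>1 \<bullet> ((B1 + B2) *v \<phi>\<^sub>1) + \<psi>\<^sub>2 \<bullet> ((B1 + B2) *v \<phi>\<^sub>2) - \<psi>\<^sub>2 \<bullet> (B2 *v \<phi>\<^sub>1)) = 0"
    by (simp add: E1 E2 mat_simps)
  have "k = 0" "t = 0"
    using det_2_trivial_kernel[OF d0[unfolded d0_def Let_def, folded AB] r1 r2] by auto
  then have 0: "x = 0" "s = 0" "t = 0" "E1 = 0" "E2 = 0"
    by (auto simp: x s E1 E2)

  have "(F1 + F2) *v a = 0"
    using k2 by (simp add: 0)
  then obtain \<alpha> where a: "a = \<alpha> *\<^sub>R \<phi>\<^sub>1"
    by (rule kernel)
  have "\<alpha> * nform1 F2 l\<^sub>1 l\<^sub>2 \<phi>\<^sub>1 = 0"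
    using k4 by (simp add: 0 a nform1_def matrix_vector_mult_scaleR algebra_simps)
  then have a0: "a = 0"
    by (simp add: a norm)
  have "(F1 + F2) *v b = 0"
    using k3 by (simp add: 0 a0)
  then obtain \<beta> where b: "b = \<beta> *\<^sub>R \<phi>\<^sub>1"
    by (rule kernel)
  \<comment> \<open>With \<open>a = 0\<close> the form \<open>nform2\<close> reduces to
    \<open>nform1\<close> at \<open>b\<close>, so the first normalization also excludes
    \<beta>.\<close>
  have "\<beta> * nform1 F2 l\<^sub>1 l\<^sub>2 \<phi>\<^sub>1 = 0"
    using k5 by (simp add: 0 a0 b nform1_def nform2_def matrix_vector_mult_scaleR algebra_simps)
  then have "b = 0"
    by (simp add: b norm)
  with 0 a0 show ?thesis
    by (simp add: zero_prod_def)
qed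

theorem theorem6:
  fixes f :: "(real^'n) \<times> (real^'n) \<times> real \<times> real \<Rightarrow> real^'n::finite"
    and r :: nat
    and l\<^sub>1 l\<^sub>2 x0 \<phi>\<^sub>1 \<phi>\<^sub>2 \<psi>\<^sub>1 \<psi>\<^sub>2 :: "real^'n"
    and lam0 mu0 :: real
  assumes "r \<ge> 2" and "class_C r f"
    and "quadratic_TB_point f l\<^sub>1 l\<^sub>2 x0 lam0 mu0 \<phi>\<^sub>1 \<phi>\<^sub>2 \<psi>\<^sub>1 \<psi>\<^sub>2"
    and "nform1 (jac2 f (x0, x0, lam0, mu0)) l\<^sub>1 l\<^sub>2 \<phi>\<^sub>1 = 1"
    and "nform2 (jac2 f (x0, x0, lam0, mu0)) l\<^sub>1 l\<^sub>2 \<phi>\<^sub>1 \<phi>\<^sub>2 = 0"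
  shows "H_sys f l\<^sub>1 l\<^sub>2 (x0, \<phi>\<^sub>1, \<phi>\<^sub>2, lam0, mu0) = 0 \<and>
         regular_at (H_sys f l\<^sub>1 l\<^sub>2) (x0, \<phi>\<^sub>1, \<phi>\<^sub>2, lam0, mu0)"
proof
  let ?z = "(x0, x0, lam0, mu0)" and ?v = "(x0, \<phi>\<^sub>1, \<phi>\<^sub>2, lam0, mu0)"
  \<comment> \<open>These facts and the two normalizations are exactly the vanishing of the five
    components.\<close>
  have "f ?z = 0" "associated_vectors (jac1 f ?z) (jac2 f ?z) \<phi>\<^sub>1 \<phi>\<^sub>2 \<psi>\<^sub>1 \<psi>\<^sub>2"
    using assms(3) by (auto simp: quadratic_TB_point_def TB_point_def Let_def)
  then show "H_sys f l\<^sub>1 l\<^sub>2 ?v = 0"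
    using assms(4,5) by (simp add: Let_def associated_vectors_def zero_prod_def)
  obtain f' J1 J2 where f': "(f has_derivative f') (at ?z)"
    and J1: "(jac1 f has_derivative J1) (at ?z)" and J2: "(jac2 f has_derivative J2) (at ?z)"
    using class_C_2_differentiable(1)[OF assms(1,2)] jac_differentiable[OF assms(1,2)]
    unfolding differentiable_def by meson
  note H' = has_derivative_H_sys[OF f' J1 J2 refl refl, of l\<^sub>1 l\<^sub>2 \<phi>\<^sub>1 \<phi>\<^sub>2]
  let ?H' = "frechet_derivative (H_sys f l\<^sub>1 l\<^sub>2) (at ?v)"
  have diff: "H_sys f l\<^sub>1 l\<^sub>2 differentiable (at ?v)"
    using H' by (rule differentiableI)
  then have lin: "linear ?H'"
    by (rule linear_frechet_derivative)
  \<comment> \<open>A trivial kernel suffices: the derivative is a linear endomorphism of a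
    finite-dimensional space, so injectivity implies surjectivity.\<close>
  have "h = 0" if "?H' h = 0" for h
  proof -
    obtain x a b s t where h: "h = (x, a, b, s, t)"
      by (cases h) auto
    show ?thesis
      using that H_sys_derivative_kernel[OF f' J1 J2 refl refl refl assms(3,4) refl refl refl,
          of x s t a b]
      by (simp add: frechet_derivative_at[OF H', symmetric] h Let_def zero_prod_def)
  qed
  then have "inj ?H'"
    using linear_injective_0[OF lin] by blast
  with lin diff show "regular_at (H_sys f l\<^sub>1 l\<^sub>2) ?v"
    by (simp add: regular_at_def bij_def linear_injective_imp_surjective)
qed

end
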